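(* Consider $\mathsf{maxQPE}_{N,\delta}$ with advice given as $t$ copies of an advice state of overlap at least $\gamma$, where $N\ge2$, $\gamma\in[1/\sqrt N,1]$, $\delta\in(0,1)$ and $t=o(1/\gamma^2)$. Then every algorithm solving this task in the known-eigenbasis case (and hence also every algorithm solving it in the unknown-eigenbasis case) has cost $\Omega(\sqrt N/\delta)$. Precisely: for every sequence of parameters $(N_n,\gamma_n,\delta_n,t_n)_{n\ge1}$ satisfying these constraints with $t_n\ge0$ integers and $t_n\gamma_n^2\to0$, there exist $c>0$ and $n_0$ such that for all $n\ge n_0$ every such algorithm has cost at least $c\sqrt{N_n}/\delta_n$.
   Context: Model of computation. The input is an unknown $N$-dimensional unitary $U$. The state space is $\mathbb{C}^N\otimes W$, where the first register is $N$-dimensional with computational basis $|0\rangle,\dots,|N-1\rangle$ and $W$ is an arbitrarily large (finite-dimensional) workspace. The algorithm may apply $U$ and $U^{-1}$ to the first register (possibly controlled by a qubit of the workspace), and arbitrary unitaries independent of $U$ to the whole space; at the end it performs a POVM (independent of $U$) which determines the classical output. The starting state is the all-zero state together with the given copies of the advice state. The cost of the algorithm is the total number of applications of $U$ and $U^{-1}$ (including controlled versions); all other operations are free. The task $\mathsf{maxQPE}_{N,\delta}$ with $t$ advice states of overlap at least $\gamma$. Let $U=\sum_{j=0}^{N-1}e^{i\theta_j}|u_j\rangle\langle u_j|$ with orthonormal eigenbasis $(|u_j\rangle)$ and $\theta_j\in[0,2\pi)$, let $\theta_{\max}=\max_j\theta_j$, and let $S$ be the span of all eigenstates with eigenphase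 $\theta_{\max}$. Input promise: $\theta_{\max}\in[0,2\pi-2\delta)$. In the known-eigenbasis case $U$ is moreover promised to be diagonal in the computational basis ($|u_j\rangle=|j\rangle$); in the unknown-eigenbasis case the eigenbasis is arbitrary and unknown. Advice: the algorithm is given $t$ copies of a state $|\alpha\rangle\in\mathbb{C}^N$ with $\|P_S|\alpha\rangle\|^2\ge\gamma^2$, where $P_S$ is the orthogonal projection onto $S$. Output: with probability at least $2/3$, a value in $[\theta_{\max}-\delta,\theta_{\max}+\delta]$ modulo $2\pi$. The algorithm (which may depend on $N,\delta,\gamma,t$) must be correct for every $U$ satisfying the promise and every valid $|\alpha\rangle$. *)

theory Defs
  imports "HOL-Analysis.Borel_Space" "Jordan_Normal_Form.Schur_Decomposition"
begin

unbundle no vec_syntax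

section \<open>Finite-dimensional linear algebra\<close>

text \<open>Note that \<open>v \<bullet>c w\<close> is linear in the first argument \<open>v\<close> and antilinear in
  \<open>w\<close>, i.e. it is the physicists' inner product of \<open>w\<close> and \<open>v\<close>.\<close>

text \<open>The order on \<^typ>\<open>complex\<close> compares real parts and requires equal imaginary parts, so the
  last condition also makes \<open>E\<close> Hermitian.\<close>

definition pos_semidef :: "nat \<Rightarrow> complex mat \<Rightarrow> bool" where
  "pos_semidef d E \<longleftrightarrow>
     E \<in> carrier_mat d d \<and> (\<forall>v \<in> carrier_vec d. 0 \<le> (E *\<^sub>v v) \<bullet>c v)"

definition unitary_mat :: "nat \<Rightarrow> complex mat \<Rightarrow> bool" where
  "unitary_mat d V \<longleftrightarrow>
     V \<in> carrier_mat d d \<and> mat_adjoint V * V = 1\<^sub>m d \<and> V * mat_adjoint V = 1\<^sub>m d"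

definition norm_sq :: "complex vec \<Rightarrow> real" where
  "norm_sq v = Re (v \<bullet>c v)"

definition orthonormal_basis :: "nat \<Rightarrow> (nat \<Rightarrow> complex vec) \<Rightarrow> bool" where
  "orthonormal_basis N u \<longleftrightarrow>
     (\<forall>j<N. u j \<in> carrier_vec N) \<and>
     (\<forall>i<N. \<forall>j<N. u i \<bullet>c u j = (if i = j then 1 else 0))"

text \<open>Kronecker products; the left factor is the more significant index.\<close>

definition kron_vec :: "complex vec \<Rightarrow> complex vec \<Rightarrow> complex vec" where
  "kron_vec v w = vec (dim_vec v * dim_vec w)
     (\<lambda>i. v $ (i div dim_vec w) * w $ (i mod dim_vec w))"

definition kron_mat :: "complex mat \<Rightarrow> complex mat \<Rightarrow> complex mat" where
  "kron_mat A B = mat (dim_row A * dim_row B) (dim_col A * dim_col B)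
     (\<lambda>(i, j). A $$ (i div dim_row B, j div dim_col B) * B $$ (i mod dim_row B, j mod dim_col B))"

primrec tensor_power :: "complex vec \<Rightarrow> nat \<Rightarrow> complex vec" where
  "tensor_power v 0 = unit_vec 1 0"
| "tensor_power v (Suc t) = kron_vec v (tensor_power v t)"

definition lin_span :: "nat \<Rightarrow> complex vec set \<Rightarrow> complex vec set" where
  "lin_span N X = LinearCombinations.module.span class_ring (module_vec TYPE(complex) N) X"

definition orth_proj :: "nat \<Rightarrow> complex vec set \<Rightarrow> complex vec \<Rightarrow> complex vec" where
  "orth_proj N S v = (THE p. p \<in> carrier_vec N \<and> p \<in> S \<and> (\<forall>s\<in>S. (v - p) \<bullet>c s = 0))"

text \<open>A POVM whose outcomes are real numbers: a countably additive map from Borel sets to positive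
  semidefinite matrices, normalised to the identity. A POVM with finitely many outcomes
  followed by a labelling of the outcomes by output values is the special case
  in which \<open>E B\<close> is the sum of the effects whose label lies in \<open>B\<close>.\<close>

definition is_povm :: "nat \<Rightarrow> (real set \<Rightarrow> complex mat) \<Rightarrow> bool" where
  "is_povm d E \<longleftrightarrow>
     (\<forall>B \<in> sets borel. pos_semidef d (E B)) \<and>
     E UNIV = 1\<^sub>m d \<and>
     (\<forall>A :: nat \<Rightarrow> real set. range A \<subseteq> sets borel \<longrightarrow> disjoint_family A \<longrightarrow>
        (\<forall>r<d. \<forall>c<d. (\<lambda>i. E (A i) $$ (r, c)) sums (E (\<Union>i. A i) $$ (r, c))))"

section \<open>Query algorithms\<close>

text \<open>The whole space is \<open>\<complex>\<^sup>N \<otimes> W\<close> with \<open>W = (\<complex>\<^sup>N)\<^sup>\<otimes>\<^sup>t \<otimes> \<complex>\<^sup>K\<close>, where the first factor of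
  \<open>W\<close> initially holds the advice and \<open>K\<close> is chosen by the algorithm. The Boolean of a
  query selects the inverse. In \<open>Controlled_Query b l r\<close> the control is the qubit in the
  middle of a factorisation \<open>W = \<complex>\<^sup>l \<otimes> \<complex>\<^sup>2 \<otimes> \<complex>\<^sup>r\<close>.\<close>

datatype gate =
    Free "complex mat"
  | Query bool
  | Controlled_Query bool nat nat

record algorithm =
  anc_dim :: nat
  gates :: "gate list"
  measurement :: "real set \<Rightarrow> complex mat"

definition work_dim :: "nat \<Rightarrow> nat \<Rightarrow> algorithm \<Rightarrow> nat" where
  "work_dim N t A = N ^ t * anc_dim A"

fun gate_ok :: "nat \<Rightarrow> nat \<Rightarrow> gate \<Rightarrow> bool" where
  "gate_ok N w (Free V) \<longleftrightarrow> unitary_mat (N * w) V"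
| "gate_ok N w (Query b) \<longleftrightarrow> True"
| "gate_ok N w (Controlled_Query b l r) \<longleftrightarrow> l * 2 * r = w"

definition algorithm_ok :: "nat \<Rightarrow> nat \<Rightarrow> algorithm \<Rightarrow> bool" where
  "algorithm_ok N t A \<longleftrightarrow>
     anc_dim A \<ge> 1 \<and>
     (\<forall>g \<in> set (gates A). gate_ok N (work_dim N t A) g) \<and>
     is_povm (N * work_dim N t A) (measurement A)"

definition query_mat :: "complex mat \<Rightarrow> bool \<Rightarrow> complex mat" where
  "query_mat U b = (if b then mat_adjoint U else U)"

definition qubit_proj :: "nat \<Rightarrow> nat \<Rightarrow> nat \<Rightarrow> complex mat" where
  "qubit_proj c l r =
     kron_mat (1\<^sub>m l) (kron_mat (mat 2 2 (\<lambda>(i, j). if i = c \<and> j = c then 1 else 0)) (1\<^sub>m r))"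

fun gate_mat :: "nat \<Rightarrow> nat \<Rightarrow> complex mat \<Rightarrow> gate \<Rightarrow> complex mat" where
  "gate_mat N w U (Free V) = V"
| "gate_mat N w U (Query b) = kron_mat (query_mat U b) (1\<^sub>m w)"
| "gate_mat N w U (Controlled_Query b l r) =
     kron_mat (1\<^sub>m N) (qubit_proj 0 l r) + kron_mat (query_mat U b) (qubit_proj 1 l r)"

definition initial_state :: "nat \<Rightarrow> nat \<Rightarrow> algorithm \<Rightarrow> complex vec \<Rightarrow> complex vec" where
  "initial_state N t A \<alpha> =
     kron_vec (unit_vec N 0) (kron_vec (tensor_power \<alpha> t) (unit_vec (anc_dim A) 0))"

definition final_state ::
  "nat \<Rightarrow> nat \<Rightarrow> algorithm \<Rightarrow> complex mat \<Rightarrow> complex vec \<Rightarrow> complex vec" where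
  "final_state N t A U \<alpha> =
     fold (\<lambda>g \<psi>. gate_mat N (work_dim N t A) U g *\<^sub>v \<psi>) (gates A) (initial_state N t A \<alpha>)"

definition output_prob ::
  "nat \<Rightarrow> nat \<Rightarrow> algorithm \<Rightarrow> complex mat \<Rightarrow> complex vec \<Rightarrow> real set \<Rightarrow> real" where
  "output_prob N t A U \<alpha> B =
     (let \<psi> = final_state N t A U \<alpha> in Re ((measurement A B *\<^sub>v \<psi>) \<bullet>c \<psi>))"

fun is_query :: "gate \<Rightarrow> bool" where
  "is_query (Free V) \<longleftrightarrow> False"
| "is_query (Query b) \<longleftrightarrow> True"
| "is_query (Controlled_Query b l r) \<longleftrightarrow> True"

definition cost :: "algorithm \<Rightarrow> nat" where
  "cost A = length (filter is_query (gates A))"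

section \<open>Maximum phase estimation with advice\<close>

definition spectral_unitary ::
  "nat \<Rightarrow> (nat \<Rightarrow> complex vec) \<Rightarrow> (nat \<Rightarrow> real) \<Rightarrow> complex mat" where
  "spectral_unitary N u \<theta> =
     mat N N (\<lambda>(a, b). \<Sum>j<N. exp (\<i> * complex_of_real (\<theta> j)) * (u j $ a * cnj (u j $ b)))"

definition theta_max :: "nat \<Rightarrow> (nat \<Rightarrow> real) \<Rightarrow> real" where
  "theta_max N \<theta> = Max (\<theta> ` {..<N})"

definition max_eigenspace ::
  "nat \<Rightarrow> (nat \<Rightarrow> complex vec) \<Rightarrow> (nat \<Rightarrow> real) \<Rightarrow> complex vec set" where
  "max_eigenspace N u \<theta> = lin_span N {u j | j. j < N \<and> \<theta> j = theta_max N \<theta>}"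

definition maxqpe_promise ::
  "nat \<Rightarrow> real \<Rightarrow> (nat \<Rightarrow> complex vec) \<Rightarrow> (nat \<Rightarrow> real) \<Rightarrow> bool" where
  "maxqpe_promise N \<delta> u \<theta> \<longleftrightarrow>
     orthonormal_basis N u \<and>
     (\<forall>j<N. 0 \<le> \<theta> j \<and> \<theta> j < 2 * pi) \<and>
     0 \<le> theta_max N \<theta> \<and> theta_max N \<theta> < 2 * pi - 2 * \<delta>"

definition valid_advice ::
  "nat \<Rightarrow> real \<Rightarrow> (nat \<Rightarrow> complex vec) \<Rightarrow> (nat \<Rightarrow> real) \<Rightarrow> complex vec \<Rightarrow> bool" where
  "valid_advice N \<gamma> u \<theta> \<alpha> \<longleftrightarrow>
     \<alpha> \<in> carrier_vec N \<and> norm_sq \<alpha> = 1 \<and>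
     norm_sq (orth_proj N (max_eigenspace N u \<theta>) \<alpha>) \<ge> \<gamma>\<^sup>2"

definition good_outputs :: "real \<Rightarrow> real \<Rightarrow> real set" where
  "good_outputs \<delta> \<theta>m = {x. \<exists>k::int. \<theta>m - \<delta> \<le> x + 2 * pi * of_int k \<and> x + 2 * pi * of_int k \<le> \<theta>m + \<delta>}"

definition correct_on ::
  "nat \<Rightarrow> real \<Rightarrow> real \<Rightarrow> nat \<Rightarrow> algorithm \<Rightarrow> (nat \<Rightarrow> complex vec) \<Rightarrow> bool" where
  "correct_on N \<delta> \<gamma> t A u \<longleftrightarrow>
     (\<forall>\<theta> \<alpha>. maxqpe_promise N \<delta> u \<theta> \<longrightarrow> valid_advice N \<gamma> u \<theta> \<alpha> \<longrightarrow>
        output_prob N t A (spectral_unitary N u \<theta>) \<alpha> (good_outputs \<delta> (theta_max N \<theta>)) \<ge> 2 / 3)"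

definition solves_maxqpe_known ::
  "nat \<Rightarrow> real \<Rightarrow> real \<Rightarrow> nat \<Rightarrow> algorithm \<Rightarrow> bool" where
  "solves_maxqpe_known N \<delta> \<gamma> t A \<longleftrightarrow>
     algorithm_ok N t A \<and> correct_on N \<delta> \<gamma> t A (unit_vec N)"

definition solves_maxqpe_unknown ::
  "nat \<Rightarrow> real \<Rightarrow> real \<Rightarrow> nat \<Rightarrow> algorithm \<Rightarrow> bool" where
  "solves_maxqpe_unknown N \<delta> \<gamma> t A \<longleftrightarrow>
     algorithm_ok N t A \<and> (\<forall>u. correct_on N \<delta> \<gamma> t A u)"

end

theory Submission
  imports Defs "HOL-Analysis.Complex_Transcendental"
begin

unbundle no vec_syntax

text \<open>A hybrid argument. Compare the identity, with advice \<open>e\<^sub>0\<close>, to the unitaries \<open>U\<^sub>j\<close>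
  (\<open>0 < j < N\<close>) whose only nontrivial eigenphase is \<open>3 \<delta>\<close> on \<open>e\<^sub>j\<close>, with advice
  \<open>\<gamma> e\<^sub>j + sqrt (1 - \<gamma>\<^sup>2) e\<^sub>0\<close>. The outputs must differ, so the two final states are at least a
  constant apart. The initial states are within \<open>sqrt (2 t \<gamma>\<^sup>2)\<close> of each other, and each query
  increases the distance by at most \<open>3 \<delta>\<close> times the norm of the part of the current identity-run
  state supported on the query index \<open>j\<close>. By Cauchy-Schwarz these norms sum over \<open>j\<close> to at most
  \<open>sqrt (N - 1)\<close>, so the cost is of order at least \<open>(N - 1) / (\<delta> sqrt (N - 1))\<close>.\<close>

section \<open>Norms and diagonal unitaries\<close>

text \<open>Phrased through \<open>L2_set\<close>, so that its triangle inequality and its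
  Cauchy-Schwarz inequality apply directly.\<close>

definition vnorm :: "complex vec \<Rightarrow> real" where
  "vnorm v = L2_set (\<lambda>i. cmod (v $ i)) {..<dim_vec v}"

text \<open>In the known eigenbasis the unitaries, the identity and the qubit projectors all have
  this shape, so query gates can be compared entry by entry.\<close>

definition diag :: "nat \<Rightarrow> (nat \<Rightarrow> complex) \<Rightarrow> complex mat" where
  "diag n d = mat n n (\<lambda>(a, b). if a = b then d a else 0)"

lemma norm_sq_sum: "norm_sq v = (\<Sum>i<dim_vec v. (cmod (v $ i))\<^sup>2)"
  by (simp add: norm_sq_def scalar_prod_def complex_mult_cnj cmod_power2 atLeast0LessThan flip: of_real_power)

lemma vnorm_sqrt: "vnorm v = sqrt (norm_sq v)"
  by (simp add: vnorm_def L2_set_def norm_sq_sum)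

lemma vnorm_power2: "(vnorm v)\<^sup>2 = norm_sq v"
  by (simp add: vnorm_def L2_set_def norm_sq_sum sum_nonneg)

lemma vnorm_nonneg: "0 \<le> vnorm v"
  by (simp add: vnorm_def)

lemma vnorm_add_le:
  assumes "v \<in> carrier_vec n" "w \<in> carrier_vec n"
  shows "vnorm (v + w) \<le> vnorm v + vnorm w"
proof -
  have "vnorm (v + w) \<le> L2_set (\<lambda>i. cmod (v $ i) + cmod (w $ i)) {..<n}"
    using assms unfolding vnorm_def by (auto intro!: L2_set_mono norm_triangle_ineq)
  also have "\<dots> \<le> vnorm v + vnorm w"
    using L2_set_triangle_ineq assms by (auto simp: vnorm_def)
  finally show ?thesis .
qed

lemma vnorm_mono:
  assumes "dim_vec v = dim_vec w" "\<And>i. i < dim_vec v \<Longrightarrow> cmod (v $ i) \<le> cmod (w $ i)"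
  shows "vnorm v \<le> vnorm w"
  using assms unfolding vnorm_def by (auto intro!: L2_set_mono)

lemma vnorm_smult: "vnorm (c \<cdot>\<^sub>v v) = cmod c * vnorm v"
  by (auto simp: vnorm_def norm_mult L2_set_right_distrib intro!: L2_set_cong)

lemma norm_sq_minus:
  assumes "v \<in> carrier_vec n" "w \<in> carrier_vec n"
  shows "norm_sq (v - w) = norm_sq v + norm_sq w - 2 * Re (v \<bullet>c w)"
proof -
  have "norm_sq (v - w) = (\<Sum>i<n. (cmod (v $ i - w $ i))\<^sup>2)"
    using assms by (simp add: norm_sq_sum)
  also have "\<dots> = (\<Sum>i<n. (cmod (v $ i))\<^sup>2 + (cmod (w $ i))\<^sup>2 - 2 * Re (v $ i * cnj (w $ i)))"
    by (rule sum.cong) (simp_all add: cmod_power2, simp_all add: power2_eq_square algebra_simps)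
  also have "\<dots> = norm_sq v + norm_sq w - 2 * Re (v \<bullet>c w)"
    using assms
    by (simp add: norm_sq_sum scalar_prod_def sum.distrib sum_subtractf sum_distrib_left atLeast0LessThan)
  finally show ?thesis .
qed

section \<open>Adjoints and unitary matrices\<close>

lemma mat_adjoint_dim:
  "dim_row (mat_adjoint A) = dim_col A" "dim_col (mat_adjoint A) = dim_row A"
  by (simp_all add: mat_adjoint_def)

lemma mat_adjoint_index:
  fixes A :: "complex mat"
  assumes "i < dim_col A" "j < dim_row A"
  shows "mat_adjoint A $$ (i, j) = cnj (A $$ (j, i))"
  using assms by (simp add: mat_adjoint_def mat_of_rows_index col_def)

lemma mat_adjoint_cscalar:
  fixes A :: "complex mat"
  assumes A: "A \<in> carrier_mat n m" and v: "v \<in> carrier_vec m" and w: "w \<in> carrier_vec n"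
  shows "(A *\<^sub>v v) \<bullet>c w = v \<bullet>c (mat_adjoint A *\<^sub>v w)"
proof -
  have "(A *\<^sub>v v) \<bullet>c w = (\<Sum>i<n. \<Sum>j<m. A $$ (i, j) * v $ j * cnj (w $ i))"
    using assms by (auto simp: scalar_prod_def atLeast0LessThan sum_distrib_right intro!: sum.cong)
  also have "\<dots> = (\<Sum>j<m. \<Sum>i<n. A $$ (i, j) * v $ j * cnj (w $ i))"
    by (rule sum.swap)
  also have "\<dots> = v \<bullet>c (mat_adjoint A *\<^sub>v w)"
    using assms by (auto simp: scalar_prod_def atLeast0LessThan sum_distrib_left mat_adjoint_dim
      mat_adjoint_index algebra_simps intro!: sum.cong)
  finally show ?thesis .
qed

lemma unitary_mat_vnorm:
  assumes V: "unitary_mat n V" and v: "v \<in> carrier_vec n"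
  shows "vnorm (V *\<^sub>v v) = vnorm v"
proof -
  have c1: "V \<in> carrier_mat n n" and e: "mat_adjoint V * V = 1\<^sub>m n"
    using V by (simp_all only: unitary_mat_def)
  have c2: "mat_adjoint V \<in> carrier_mat n n"
    using c1 by (intro carrier_matI) (simp_all only: mat_adjoint_dim carrier_matD)
  have "(V *\<^sub>v v) \<bullet>c (V *\<^sub>v v) = v \<bullet>c (mat_adjoint V *\<^sub>v (V *\<^sub>v v))"
    using c1 v by (intro mat_adjoint_cscalar mult_mat_vec_carrier)
  also have "mat_adjoint V *\<^sub>v (V *\<^sub>v v) = v"
    using assoc_mult_mat_vec[OF c2 c1 v] v unfolding e by simp
  finally have "norm_sq (V *\<^sub>v v) = norm_sq v"
    unfolding norm_sq_def by (rule arg_cong)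
  then show ?thesis
    by (simp only: vnorm_sqrt)
qed

section \<open>Diagonal matrices and query gates\<close>

lemma diag_carrier [simp]: "diag n d \<in> carrier_mat n n"
  by (simp add: diag_def)

lemma diag_mult_vec:
  assumes "v \<in> carrier_vec n"
  shows "diag n d *\<^sub>v v = vec n (\<lambda>i. d i * v $ i)"
  using assms by (intro eq_vecI) (auto simp: diag_def scalar_prod_def if_distrib if_distribR sum.delta' cong: if_cong)

lemma one_mat_diag: "1\<^sub>m n = diag n (\<lambda>_. 1)"
  by (intro eq_matI) (auto simp: diag_def)

lemma mat_adjoint_diag: "mat_adjoint (diag n d) = diag n (\<lambda>i. cnj (d i))"
  by (intro eq_matI) (auto simp: mat_adjoint_dim mat_adjoint_index, auto simp: diag_def mat_adjoint_index)

lemma diag_add: "diag n d + diag n e = diag n (\<lambda>i. d i + e i)"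
  by (intro eq_matI) (auto simp: diag_def)

lemma diag_cong: "(\<And>i. i < n \<Longrightarrow> d i = e i) \<Longrightarrow> diag n d = diag n e"
  by (intro eq_matI) (auto simp: diag_def)

lemma kron_mat_diag:
  "kron_mat (diag n d) (diag m e) = diag (n * m) (\<lambda>i. d (i div m) * e (i mod m))"
proof (intro eq_matI)
  fix i j assume "i < dim_row (diag (n * m) (\<lambda>i. d (i div m) * e (i mod m)))"
    "j < dim_col (diag (n * m) (\<lambda>i. d (i div m) * e (i mod m)))"
  then have ij: "i < n * m" "j < n * m" by (auto simp: diag_def)
  then have "m > 0" by (cases m) auto
  then have "i div m < n" "j div m < n" "i mod m < m" "j mod m < m"
    using ij by (auto simp: less_mult_imp_div_less)
  moreover have "i = j \<longleftrightarrow> i div m = j div m \<and> i mod m = j mod m"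
    by (metis div_mult_mod_eq)
  ultimately show "kron_mat (diag n d) (diag m e) $$ (i, j) =
      diag (n * m) (\<lambda>i. d (i div m) * e (i mod m)) $$ (i, j)"
    using ij by (simp add: kron_mat_def diag_def)
qed (auto simp: kron_mat_def diag_def)

lemma qubit_proj_diag:
  "qubit_proj c l r = diag (l * 2 * r) (\<lambda>i. if (i mod (2 * r)) div r = c then 1 else 0)"
proof -
  have *: "mat 2 2 (\<lambda>(i, j). if i = c \<and> j = c then 1 else 0) = diag 2 (\<lambda>i. if i = c then 1 else 0)"
    by (intro eq_matI) (auto simp: diag_def)
  show ?thesis
    unfolding qubit_proj_def * one_mat_diag kron_mat_diag by (simp add: mult.assoc)
qed

text \<open>The left tensor factor is the more significant one, so \<open>i div w\<close> is the
  content of the query register. \<open>act\<close> marks where the gate acts: everywhere for a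
  plain query, where the control qubit is 1 for a controlled one. Neither \<open>act\<close> nor
  \<open>b\<close> depends on \<open>d\<close>, so one description serves all the unitaries that are
  compared.\<close>

lemma query_gate_diag:
  assumes "is_query g" "gate_ok N w g"
  obtains act b where "\<And>d. gate_mat N w (diag N d) g =
    diag (N * w) (\<lambda>i. if act i then (if b then cnj (d (i div w)) else d (i div w)) else 1)"
proof (cases g)
  case (Query b)
  have "gate_mat N w (diag N d) g =
    diag (N * w) (\<lambda>i. if True then (if b then cnj (d (i div w)) else d (i div w)) else 1)" for d
    unfolding Query by (cases b) (simp_all add: query_mat_def mat_adjoint_diag one_mat_diag kron_mat_diag)
  then show ?thesis by (rule that)
next
  case (Controlled_Query b l r)
  with assms have w: "l * 2 * r = w" by simp
  define bit where "bit i = (i mod w mod (2 * r)) div r" for i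
  have bit: "bit i = 0 \<or> bit i = 1" if "i < N * w" for i
  proof -
    have "r > 0" using that w by (cases r) auto
    then have "bit i < 2" unfolding bit_def by (simp add: less_mult_imp_div_less)
    then show ?thesis by auto
  qed
  have "gate_mat N w (diag N d) g =
    diag (N * w) (\<lambda>i. if bit i = 1 then (if b then cnj (d (i div w)) else d (i div w)) else 1)" for d
  proof -
    define e where "e i = (if b then cnj (d i) else d i)" for i
    have q: "query_mat (diag N d) b = diag N e"
      unfolding query_mat_def mat_adjoint_diag e_def by (cases b) simp_all
    have "gate_mat N w (diag N d) g = diag (N * w) (\<lambda>i. 1 * (if bit i = 0 then 1 else 0) +
        e (i div w) * (if bit i = 1 then 1 else 0))"
      unfolding Controlled_Query gate_mat.simps q one_mat_diag qubit_proj_diag w kron_mat_diag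
        diag_add bit_def ..
    \<comment> \<open>The control qubit is 0 or 1, so exactly one of the two projectors
      contributes.\<close>
    also have "\<dots> = diag (N * w) (\<lambda>i. if bit i = 1 then e (i div w) else 1)"
    proof (rule diag_cong)
      fix i assume "i < N * w"
      from bit[OF this] show "1 * (if bit i = 0 then 1 else 0) + e (i div w) * (if bit i = 1 then 1 else 0) =
          (if bit i = 1 then e (i div w) else 1)"
        by (elim disjE) simp_all
    qed
    finally show ?thesis unfolding e_def .
  qed
  then show ?thesis by (rule that)
qed (use assms in auto)

section \<open>Hybrid argument\<close>

text \<open>The component of \<open>v\<close> whose query register holds \<open>j\<close>: the only
  part that a query can alter when \<open>j\<close> carries the only nontrivial phase.\<close>

definition block :: "nat \<Rightarrow> nat \<Rightarrow> complex vec \<Rightarrow> complex vec" where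
  "block w j v = vec (dim_vec v) (\<lambda>i. if i div w = j then v $ i else 0)"

text \<open>Distinct blocks have disjoint supports, so their squared norms add up to at most that of
  \<open>v\<close>; Cauchy-Schwarz against the constant 1 gives the square root.\<close>

lemma sum_vnorm_block:
  assumes "finite J"
  shows "(\<Sum>j\<in>J. vnorm (block w j v)) \<le> sqrt (real (card J)) * vnorm v"
proof -
  have "(\<Sum>j\<in>J. (vnorm (block w j v))\<^sup>2) = (\<Sum>i<dim_vec v. \<Sum>j\<in>J. if i div w = j then (cmod (v $ i))\<^sup>2 else 0)"
    unfolding vnorm_power2 norm_sq_sum
    by (subst sum.swap) (auto simp: block_def intro!: sum.cong)
  also have "\<dots> \<le> (\<Sum>i<dim_vec v. (cmod (v $ i))\<^sup>2)"
    using assms by (intro sum_mono) (auto simp: sum.delta)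
  also have "\<dots> = (vnorm v)\<^sup>2"
    by (simp add: vnorm_power2 norm_sq_sum)
  finally have *: "L2_set (\<lambda>j. vnorm (block w j v)) J \<le> vnorm v"
    using vnorm_nonneg by (auto simp: L2_set_def intro: real_le_lsqrt sum_nonneg)
  have "(\<Sum>j\<in>J. vnorm (block w j v)) = (\<Sum>j\<in>J. \<bar>1\<bar> * \<bar>vnorm (block w j v)\<bar>)"
    by (simp add: vnorm_nonneg)
  also have "\<dots> \<le> L2_set (\<lambda>_. 1) J * L2_set (\<lambda>j. vnorm (block w j v)) J"
    by (rule L2_set_mult_ineq)
  also have "\<dots> \<le> sqrt (real (card J)) * vnorm v"
    using * by (simp add: L2_set_def mult_left_mono)
  finally show ?thesis .
qed

section \<open>The effect of a single gate\<close>

lemma gate_mat_carrier: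
  assumes "gate_ok N w g"
  shows "gate_mat N w (diag N d) g \<in> carrier_mat (N * w) (N * w)"
proof (cases "is_query g")
  case True
  then show ?thesis using query_gate_diag[OF True assms] by (metis diag_carrier)
next
  case False
  then show ?thesis using assms by (cases g) (auto simp: unitary_mat_def)
qed

text \<open>All phases are 1, so it does not matter where the query acts. Hence only the free gates
  change the state in the reference run.\<close>

lemma gate_mat_one_query:
  assumes "is_query g" "gate_ok N w g" "v \<in> carrier_vec (N * w)"
  shows "gate_mat N w (diag N (\<lambda>_. 1)) g *\<^sub>v v = v"
proof -
  obtain act b where "\<And>d. gate_mat N w (diag N d) g =
    diag (N * w) (\<lambda>i. if act i then (if b then cnj (d (i div w)) else d (i div w)) else 1)"
    using query_gate_diag[OF assms(1,2)] by blast
  then have "gate_mat N w (diag N (\<lambda>_. 1)) g = 1\<^sub>m (N * w)"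
    by (auto simp: one_mat_diag intro!: diag_cong)
  then show ?thesis using assms by simp
qed

lemma gate_mat_vnorm:
  assumes "gate_ok N w g" "v \<in> carrier_vec (N * w)" "\<And>i. cmod (d i) = 1"
  shows "vnorm (gate_mat N w (diag N d) g *\<^sub>v v) = vnorm v"
proof (cases "is_query g")
  case True
  then obtain act b where "\<And>d. gate_mat N w (diag N d) g =
    diag (N * w) (\<lambda>i. if act i then (if b then cnj (d (i div w)) else d (i div w)) else 1)"
    using query_gate_diag assms(1) by blast
  then show ?thesis
    using assms by (auto simp: diag_mult_vec vnorm_def norm_mult intro!: L2_set_cong)
next
  case False
  then show ?thesis using assms by (cases g) (auto simp: unitary_mat_vnorm)
qed

text \<open>Only entries of block \<open>j\<close> can change; there the change is multiplication by
  \<open>d j - 1\<close> or its conjugate, which have equal modulus.\<close>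

lemma query_gate_deviation:
  assumes "is_query g" "gate_ok N w g" "v \<in> carrier_vec (N * w)" "\<And>i. i \<noteq> j \<Longrightarrow> d i = 1"
  shows "vnorm (gate_mat N w (diag N d) g *\<^sub>v v - v) \<le> cmod (d j - 1) * vnorm (block w j v)"
proof -
  obtain act b where g: "\<And>d. gate_mat N w (diag N d) g =
    diag (N * w) (\<lambda>i. if act i then (if b then cnj (d (i div w)) else d (i div w)) else 1)"
    using query_gate_diag[OF assms(1,2)] by blast
  have *: "cmod (a * x - x) = cmod (a - 1) * cmod x" for a x
    by (simp add: left_diff_distrib flip: norm_mult)
  have "cmod (cnj (d j) - 1) = cmod (d j - 1)"
    using complex_mod_cnj[of "d j - 1"] by simp
  then have "vnorm (gate_mat N w (diag N d) g *\<^sub>v v - v) \<le> vnorm ((d j - 1) \<cdot>\<^sub>v block w j v)"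
    using assms(3,4) by (intro vnorm_mono) (auto simp: g diag_mult_vec block_def * norm_mult)
  then show ?thesis by (simp add: vnorm_smult)
qed

text \<open>For a query \<open>G\<close>, write \<open>G v' - v = G (v' - v) + (G v - v)\<close>.
  The first term has the norm of \<open>v' - v\<close> since \<open>G\<close> is isometric; the
  second is measured on the reference state \<open>v\<close>, not on \<open>v'\<close>. A free gate
  is the same for both unitaries and adds nothing.\<close>

lemma gate_mat_hybrid:
  assumes "gate_ok N w g" "v \<in> carrier_vec (N * w)" "v' \<in> carrier_vec (N * w)"
    and "\<And>i. i \<noteq> j \<Longrightarrow> d i = 1" "cmod (d j) = 1"
  shows "vnorm (gate_mat N w (diag N d) g *\<^sub>v v' - gate_mat N w (diag N (\<lambda>_. 1)) g *\<^sub>v v) \<le>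
    vnorm (v' - v) + (if is_query g then cmod (d j - 1) * vnorm (block w j v) else 0)"
proof -
  have d: "cmod (d i) = 1" for i using assms(4,5) by (cases "i = j") auto
  let ?G = "gate_mat N w (diag N d) g"
  have G: "?G \<in> carrier_mat (N * w) (N * w)" by (rule gate_mat_carrier) fact
  have sub: "?G *\<^sub>v (v' - v) = ?G *\<^sub>v v' - ?G *\<^sub>v v"
    using G assms by (intro mult_minus_distrib_mat_vec) auto
  show ?thesis
  proof (cases "is_query g")
    case True
    have "?G *\<^sub>v v' - v = ?G *\<^sub>v (v' - v) + (?G *\<^sub>v v - v)"
      unfolding sub using G assms(2,3) by (intro eq_vecI) auto
    then have "vnorm (?G *\<^sub>v v' - v) \<le> vnorm (?G *\<^sub>v (v' - v)) + vnorm (?G *\<^sub>v v - v)"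
      using G assms(2,3) by (auto intro!: vnorm_add_le[of _ "N * w"])
    also have "vnorm (?G *\<^sub>v (v' - v)) = vnorm (v' - v)"
      using assms d by (intro gate_mat_vnorm) auto
    also have "vnorm (?G *\<^sub>v v - v) \<le> cmod (d j - 1) * vnorm (block w j v)"
      using True assms by (intro query_gate_deviation) auto
    finally show ?thesis using True assms by (simp add: gate_mat_one_query)
  next
    case False
    then have "gate_mat N w (diag N (\<lambda>_. 1)) g = ?G" by (cases g) auto
    then show ?thesis
      using False sub gate_mat_vnorm[of N w g "v' - v" d] assms d by auto
  qed
qed

section \<open>Runs of a gate list from an arbitrary start vector\<close>

definition run :: "nat \<Rightarrow> nat \<Rightarrow> complex mat \<Rightarrow> gate list \<Rightarrow> complex vec \<Rightarrow> complex vec" where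
  "run N w U gs v = fold (\<lambda>g \<psi>. gate_mat N w U g *\<^sub>v \<psi>) gs v"

lemma run_carrier:
  assumes "\<forall>g\<in>set gs. gate_ok N w g" "v \<in> carrier_vec (N * w)"
  shows "run N w (diag N d) gs v \<in> carrier_vec (N * w)"
  using assms unfolding run_def
proof (induction gs arbitrary: v)
  case (Cons g gs)
  then show ?case using gate_mat_carrier[of N w g d] by (auto intro!: Cons.IH)
qed auto

lemma run_vnorm:
  assumes "\<forall>g\<in>set gs. gate_ok N w g" "v \<in> carrier_vec (N * w)" "\<And>i. cmod (d i) = 1"
  shows "vnorm (run N w (diag N d) gs v) = vnorm v"
  using assms(1,2) unfolding run_def
proof (induction gs arbitrary: v)
  case (Cons g gs)
  then show ?case
    using gate_mat_carrier[of N w g d] gate_mat_vnorm[of N w g v d] assms(3) by auto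
qed auto

text \<open>The sum over \<open>j\<close> is taken inside the induction: at each query all instances
  are charged on one common reference state, so \<open>sum_vnorm_block\<close> yields a factor
  \<open>sqrt (card J)\<close> instead of \<open>card J\<close>.\<close>

lemma hybrid_bound:
  fixes \<kappa> :: real
  assumes "finite J" "\<forall>g\<in>set gs. gate_ok N w g"
    and "v \<in> carrier_vec (N * w)" "\<And>j. j \<in> J \<Longrightarrow> v' j \<in> carrier_vec (N * w)"
    and d: "\<And>i j. i \<noteq> j \<Longrightarrow> d j i = 1" "\<And>j. cmod (d j j) = 1" "\<And>j. cmod (d j j - 1) \<le> \<kappa>"
  shows "(\<Sum>j\<in>J. vnorm (run N w (diag N (d j)) gs (v' j) - run N w (diag N (\<lambda>_. 1)) gs v)) \<le>
    (\<Sum>j\<in>J. vnorm (v' j - v)) + \<kappa> * sqrt (real (card J)) * real (length (filter is_query gs)) * vnorm v"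
  using assms(2-4)
proof (induction gs arbitrary: v v')
  case Nil
  then show ?case by (simp add: run_def)
next
  case (Cons g gs)
  have \<kappa>: "0 \<le> \<kappa>" using order_trans[OF norm_ge_zero d(3)] .
  let ?G = "\<lambda>j. gate_mat N w (diag N (d j)) g" and ?I = "gate_mat N w (diag N (\<lambda>_. 1)) g"
  let ?q = "real (length (filter is_query gs))"
  have g: "gate_ok N w g" using Cons.prems by auto
  have "(\<Sum>j\<in>J. vnorm (?G j *\<^sub>v v' j - ?I *\<^sub>v v)) \<le>
      (\<Sum>j\<in>J. vnorm (v' j - v) + (if is_query g then \<kappa> * vnorm (block w j v) else 0))"
  proof (rule sum_mono)
    fix j assume "j \<in> J"
    then have "vnorm (?G j *\<^sub>v v' j - ?I *\<^sub>v v) \<le>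
        vnorm (v' j - v) + (if is_query g then cmod (d j j - 1) * vnorm (block w j v) else 0)"
      using g Cons.prems d by (intro gate_mat_hybrid) auto
    also have "\<dots> \<le> vnorm (v' j - v) + (if is_query g then \<kappa> * vnorm (block w j v) else 0)"
      using d(3) by (auto intro!: mult_right_mono vnorm_nonneg)
    finally show "vnorm (?G j *\<^sub>v v' j - ?I *\<^sub>v v) \<le>
        vnorm (v' j - v) + (if is_query g then \<kappa> * vnorm (block w j v) else 0)" .
  qed
  also have "\<dots> = (\<Sum>j\<in>J. vnorm (v' j - v)) +
      (if is_query g then \<kappa> * (\<Sum>j\<in>J. vnorm (block w j v)) else 0)"
    by (simp add: sum.distrib sum_distrib_left)
  also have "\<dots> \<le> (\<Sum>j\<in>J. vnorm (v' j - v)) +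
      (if is_query g then \<kappa> * (sqrt (real (card J)) * vnorm v) else 0)"
    using sum_vnorm_block[OF assms(1)] \<kappa> by (auto intro!: mult_left_mono)
  finally have 1: "(\<Sum>j\<in>J. vnorm (?G j *\<^sub>v v' j - ?I *\<^sub>v v)) \<le> \<dots>" .
  have "(\<Sum>j\<in>J. vnorm (run N w (diag N (d j)) gs (?G j *\<^sub>v v' j) - run N w (diag N (\<lambda>_. 1)) gs (?I *\<^sub>v v)))
    \<le> (\<Sum>j\<in>J. vnorm (?G j *\<^sub>v v' j - ?I *\<^sub>v v)) + \<kappa> * sqrt (real (card J)) * ?q * vnorm (?I *\<^sub>v v)"
    using Cons.prems by (auto intro!: Cons.IH mult_mat_vec_carrier[OF gate_mat_carrier[OF g]])
  \<comment> \<open>The reference run keeps its norm, so all later queries are charged against the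
    same \<open>vnorm v\<close>.\<close>
  moreover have "vnorm (?I *\<^sub>v v) = vnorm v"
    using g Cons.prems by (intro gate_mat_vnorm) auto
  ultimately show ?case
    using 1 by (auto simp: run_def algebra_simps)
qed

section \<open>Initial states\<close>

lemma kron_vec_carrier:
  "v \<in> carrier_vec n \<Longrightarrow> w \<in> carrier_vec m \<Longrightarrow> kron_vec v w \<in> carrier_vec (n * m)"
  by (auto simp: kron_vec_def)

text \<open>Splitting the index \<open>k\<close> into \<open>k div m\<close> and
  \<open>k mod m\<close> turns the sum into one over pairs, which factorises.\<close>

lemma kron_vec_cscalar:
  assumes "v \<in> carrier_vec n" "v' \<in> carrier_vec n" "w \<in> carrier_vec m" "w' \<in> carrier_vec m"
  shows "kron_vec v w \<bullet>c kron_vec v' w' = (v \<bullet>c v') * (w \<bullet>c w')"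
proof -
  have "kron_vec v w \<bullet>c kron_vec v' w' =
      (\<Sum>k<m * n. v $ (k div m) * cnj (v' $ (k div m)) * (w $ (k mod m) * cnj (w' $ (k mod m))))"
    using assms by (auto simp: kron_vec_def scalar_prod_def atLeast0LessThan mult_ac intro!: sum.cong)
  also have "\<dots> = (\<Sum>(i, j)\<in>{..<n} \<times> {..<m}. v $ i * cnj (v' $ i) * (w $ j * cnj (w' $ j)))"
  proof (rule sum.reindex_bij_witness[of _ "\<lambda>(i, j). i * m + j" "\<lambda>k. (k div m, k mod m)"])
    fix k assume k: "k \<in> {..<m * n}"
    then have "m > 0" by (cases m) auto
    with k show "(k div m, k mod m) \<in> {..<n} \<times> {..<m}"
      by (auto simp: less_mult_imp_div_less mult.commute)
  next
    fix p assume "p \<in> {..<n} \<times> {..<m}"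
    then obtain i j where p: "p = (i, j)" "i < n" "j < m" by auto
    have "i * m + j < Suc i * m" using p by simp
    also have "\<dots> \<le> m * n" using p by (metis Suc_leI mult.commute mult_le_mono2)
    finally show "(case p of (i, j) \<Rightarrow> i * m + j) \<in> {..<m * n}" using p by simp
  qed auto
  also have "\<dots> = (\<Sum>i<n. \<Sum>j<m. v $ i * cnj (v' $ i) * (w $ j * cnj (w' $ j)))"
    by (simp add: sum.cartesian_product)
  also have "\<dots> = (v \<bullet>c v') * (w \<bullet>c w')"
    using assms by (auto simp: scalar_prod_def atLeast0LessThan sum_product)
  finally show ?thesis .
qed

lemma tensor_power_carrier: "v \<in> carrier_vec n \<Longrightarrow> tensor_power v t \<in> carrier_vec (n ^ t)"
  by (induction t) (auto intro: kron_vec_carrier)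

lemma tensor_power_cscalar:
  assumes "v \<in> carrier_vec n" "w \<in> carrier_vec n"
  shows "tensor_power v t \<bullet>c tensor_power w t = (v \<bullet>c w) ^ t"
proof (induction t)
  case (Suc t)
  then show ?case
    using assms by (simp add: kron_vec_cscalar[OF assms tensor_power_carrier tensor_power_carrier])
qed (simp add: scalar_prod_def)

lemma cscalar_unit_vec:
  fixes v :: "complex vec"
  assumes "v \<in> carrier_vec n" "i < n"
  shows "v \<bullet>c unit_vec n i = v $ i"
proof -
  have "conjugate (unit_vec n i :: complex vec) = unit_vec n i"
    by (intro eq_vecI) (auto simp: unit_vec_def)
  then show ?thesis using assms by (simp add: scalar_prod_right_unit)
qed

lemma unit_vec_cscalar:
  "i < n \<Longrightarrow> j < n \<Longrightarrow> (unit_vec n i :: complex vec) \<bullet>c unit_vec n j = (if i = j then 1 else 0)"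
  by (simp add: cscalar_unit_vec[of _ n])

lemma norm_sq_unit_vec: "i < n \<Longrightarrow> norm_sq (unit_vec n i) = 1"
  by (simp add: norm_sq_def unit_vec_cscalar)

lemma initial_state_carrier:
  assumes "\<alpha> \<in> carrier_vec N"
  shows "initial_state N t A \<alpha> \<in> carrier_vec (N * work_dim N t A)"
  unfolding initial_state_def work_dim_def
  using assms by (intro kron_vec_carrier tensor_power_carrier) auto

text \<open>The query register and the ancilla start in fixed unit vectors and contribute 1; only
  the copies of the advice matter.\<close>

lemma initial_state_cscalar:
  assumes "\<alpha> \<in> carrier_vec N" "\<beta> \<in> carrier_vec N" "N > 0" "anc_dim A > 0"
  shows "initial_state N t A \<alpha> \<bullet>c initial_state N t A \<beta> = (\<alpha> \<bullet>c \<beta>) ^ t"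
proof -
  have a: "unit_vec (anc_dim A) 0 \<in> carrier_vec (anc_dim A)" by simp
  note t = tensor_power_carrier[OF assms(1), of t] tensor_power_carrier[OF assms(2), of t]
  note k = kron_vec_carrier[OF t(1) a] kron_vec_carrier[OF t(2) a]
  show ?thesis
    unfolding initial_state_def kron_vec_cscalar[OF unit_vec_carrier unit_vec_carrier k]
      kron_vec_cscalar[OF t a a] tensor_power_cscalar[OF assms(1,2)]
      unit_vec_cscalar[OF assms(3,3)] unit_vec_cscalar[OF assms(4,4)] by simp
qed

section \<open>Distinguishing states by a POVM\<close>

text \<open>The outcome probability of an effect \<open>M\<close> on a unit vector \<open>v\<close>;
  below it is also evaluated on differences of states.\<close>

definition quad_form :: "complex mat \<Rightarrow> complex vec \<Rightarrow> real" where
  "quad_form M v = Re ((M *\<^sub>v v) \<bullet>c v)"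

lemma quad_form_sum:
  assumes "M \<in> carrier_mat n n" "v \<in> carrier_vec n"
  shows "quad_form M v = Re (\<Sum>i<n. \<Sum>j<n. M $$ (i, j) * v $ j * cnj (v $ i))"
  using assms unfolding quad_form_def
  by (auto simp: scalar_prod_def atLeast0LessThan sum_distrib_right intro!: arg_cong[where f = Re] sum.cong)

lemma quad_form_one: "v \<in> carrier_vec n \<Longrightarrow> quad_form (1\<^sub>m n) v = norm_sq v"
  by (simp add: quad_form_def norm_sq_def)

lemma quad_form_nonneg: "pos_semidef n M \<Longrightarrow> v \<in> carrier_vec n \<Longrightarrow> 0 \<le> quad_form M v"
  unfolding pos_semidef_def quad_form_def by (auto simp: less_eq_complex_def)

text \<open>The right-hand side exceeds the left by half the form at \<open>a - 2 b\<close>.\<close>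

lemma quad_form_add_le:
  assumes M: "pos_semidef n M" and ab: "a \<in> carrier_vec n" "b \<in> carrier_vec n"
  shows "quad_form M (a + b) \<le> 3 / 2 * quad_form M a + 3 * quad_form M b"
proof -
  have c: "M \<in> carrier_mat n n" using M by (simp add: pos_semidef_def)
  have m: "a - 2 \<cdot>\<^sub>v b \<in> carrier_vec n" "a + b \<in> carrier_vec n" using ab by auto
  let ?s = "\<lambda>v :: complex vec. \<Sum>i<n. \<Sum>j<n. M $$ (i, j) * v $ j * cnj (v $ i)"
  have "?s (a + b) + 1 / 2 * ?s (a - 2 \<cdot>\<^sub>v b) = 3 / 2 * ?s a + 3 * ?s b"
    unfolding sum_distrib_left sum.distrib[symmetric]
    using ab by (intro sum.cong refl) (simp add: field_simps)
  then have "Re (?s (a + b) + 1 / 2 * ?s (a - 2 \<cdot>\<^sub>v b)) = Re (3 / 2 * ?s a + 3 * ?s b)"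
    by (rule arg_cong)
  then have "quad_form M (a + b) + 1 / 2 * quad_form M (a - 2 \<cdot>\<^sub>v b) = 3 / 2 * quad_form M a + 3 * quad_form M b"
    by (simp add: quad_form_sum[OF c] ab m del: index_add_vec index_minus_vec)
  with quad_form_nonneg[OF M m(1)] show ?thesis by simp
qed

text \<open>Finite additivity from countable additivity: \<open>binaryset\<close> extends the pair
  \<open>A\<close>, \<open>B\<close> by empty sets, whose effect must first be shown to be
  zero.\<close>

lemma povm_union:
  assumes E: "is_povm n E" and AB: "A \<in> sets borel" "B \<in> sets borel" "A \<inter> B = {}"
    and v: "v \<in> carrier_vec n"
  shows "quad_form (E (A \<union> B)) v = quad_form (E A) v + quad_form (E B) v"
proof -
  have c: "E C \<in> carrier_mat n n" if "C \<in> sets borel" for C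
    using E that by (auto simp: is_povm_def pos_semidef_def)
  have sums: "(\<lambda>i. E (F i) $$ (r, s)) sums (E (\<Union>i. F i) $$ (r, s))"
    if "range F \<subseteq> sets borel" "disjoint_family F" "r < n" "s < n" for F r s
    using E that unfolding is_povm_def by blast
  \<comment> \<open>Countable additivity for the constant sequence of empty sets makes a constant
    series converge, which forces its term to vanish.\<close>
  have empty: "E {} $$ (r, s) = 0" if rs: "r < n" "s < n" for r s
  proof -
    have "(\<lambda>i::nat. E {} $$ (r, s)) sums (E {} $$ (r, s))"
      using sums[OF _ _ rs, of "\<lambda>_. {}"] by (simp add: disjoint_family_on_def)
    then show ?thesis using sums_summable summable_const_iff by blast
  qed
  have "E (A \<union> B) $$ (r, s) = E A $$ (r, s) + E B $$ (r, s)" if rs: "r < n" "s < n" for r s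
  proof -
    have "range (binaryset A B) \<subseteq> sets borel" "disjoint_family (binaryset A B)"
      using AB by (auto simp: range_binaryset_eq disjoint_family_on_def binaryset_def)
    from sums[OF this rs] have "(\<lambda>i. E (binaryset A B i) $$ (r, s)) sums (E (A \<union> B) $$ (r, s))"
      by (simp only: UN_binaryset_eq)
    moreover have "(\<lambda>i. E (binaryset A B i) $$ (r, s)) sums (\<Sum>i\<in>{0, 1}. E (binaryset A B i) $$ (r, s))"
      using empty rs by (intro sums_finite) (auto simp: binaryset_def)
    ultimately show ?thesis
      by (auto simp: binaryset_def dest: sums_unique2)
  qed
  then have *: "(\<Sum>i<n. \<Sum>j<n. E (A \<union> B) $$ (i, j) * v $ j * cnj (v $ i)) =
      (\<Sum>i<n. \<Sum>j<n. E A $$ (i, j) * v $ j * cnj (v $ i)) + (\<Sum>i<n. \<Sum>j<n. E B $$ (i, j) * v $ j * cnj (v $ i))"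
    unfolding sum.distrib[symmetric] by (intro sum.cong refl) (simp add: distrib_right)
  show ?thesis
    unfolding quad_form_sum[OF c[OF AB(1)] v] quad_form_sum[OF c[OF AB(2)] v]
      quad_form_sum[OF c[OF sets.Un[OF AB(1,2)]] v] * plus_complex.sel ..
qed

text \<open>The effects of \<open>A\<close> and its complement sum to the identity, and both forms
  are nonnegative.\<close>

lemma povm_le_norm_sq:
  assumes E: "is_povm n E" and A: "A \<in> sets borel" and v: "v \<in> carrier_vec n"
  shows "quad_form (E A) v \<le> norm_sq v"
proof -
  have A': "- A \<in> sets borel" using A by auto
  have "quad_form (E A) v + quad_form (E (- A)) v = quad_form (E (A \<union> - A)) v"
    by (rule povm_union[symmetric]) (use E A A' v in auto)
  also have "\<dots> = norm_sq v"
    using E v by (simp add: is_povm_def quad_form_one)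
  finally show ?thesis
    using quad_form_nonneg[of n "E (- A)" v] E A' v by (auto simp: is_povm_def)
qed

text \<open>On \<open>w\<close> the outcome \<open>A\<close> has probability at most 1/3, because
  \<open>B\<close> takes at least 2/3. Then \<open>quad_form_add_le\<close> at
  \<open>w + (v - w)\<close> gives \<open>2/3 \<le> 3/2 * 1/3 + 3 * norm_sq (v - w)\<close>, that
  is, the bound 1/18.\<close>

lemma povm_distinguish:
  assumes E: "is_povm n E" and AB: "A \<in> sets borel" "B \<in> sets borel" "A \<inter> B = {}"
    and vw: "v \<in> carrier_vec n" "w \<in> carrier_vec n" and w1: "norm_sq w = 1"
    and p: "quad_form (E A) v \<ge> 2 / 3" "quad_form (E B) w \<ge> 2 / 3"
  shows "norm_sq (v - w) \<ge> 1 / 18"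
proof -
  have "quad_form (E A) w + quad_form (E B) w \<le> 1"
    using povm_le_norm_sq[OF E _ vw(2), of "A \<union> B"] povm_union[OF E AB vw(2)] AB w1 by auto
  then have "quad_form (E A) w \<le> 1 / 3" using p by simp
  moreover have "quad_form (E A) (w + (v - w)) \<le> 3 / 2 * quad_form (E A) w + 3 * quad_form (E A) (v - w)"
    by (rule quad_form_add_le[of n]) (use E AB vw in \<open>auto simp: is_povm_def\<close>)
  moreover have "w + (v - w) = v" using vw by (intro eq_vecI) auto
  moreover have "quad_form (E A) (v - w) \<le> norm_sq (v - w)"
    using povm_le_norm_sq[OF E AB(1)] vw by auto
  ultimately show ?thesis using p(1) by simp
qed

section \<open>Hard instances\<close>

lemma good_outputs_borel: "good_outputs \<delta> x \<in> sets borel"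
proof -
  have "good_outputs \<delta> x = (\<Union>k::int. {x - \<delta> - 2 * pi * of_int k .. x + \<delta> - 2 * pi * of_int k})"
    by (auto simp: good_outputs_def algebra_simps)
  also have "\<dots> \<in> sets borel"
    by (rule sets.countable_UN'') (auto intro: borel_closed)
  finally show ?thesis .
qed

text \<open>A common output would have representatives in
  \<open>[2 * \<delta>, 4 * \<delta>]\<close> and in \<open>[- \<delta>, \<delta>]\<close>. Their
  difference is at least \<delta> > 0 and at most 5 \<delta> < 6, but no multiple of 2 pi lies
  strictly between 0 and 6.\<close>

lemma good_outputs_disjoint:
  assumes "0 < \<delta>" "\<delta> < 1"
  shows "good_outputs \<delta> (3 * \<delta>) \<inter> good_outputs \<delta> 0 = {}"
proof (rule ccontr)
  assume "good_outputs \<delta> (3 * \<delta>) \<inter> good_outputs \<delta> 0 \<noteq> {}"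
  then obtain x and k l :: int where
    "3 * \<delta> - \<delta> \<le> x + 2 * pi * of_int k" "x + 2 * pi * of_int k \<le> 3 * \<delta> + \<delta>"
    "0 - \<delta> \<le> x + 2 * pi * of_int l" "x + 2 * pi * of_int l \<le> 0 + \<delta>"
    by (auto simp: good_outputs_def)
  then have "0 < 2 * pi * of_int k - 2 * pi * of_int l" "2 * pi * of_int k - 2 * pi * of_int l < 6"
    using assms by linarith+
  then have *: "0 < 2 * pi * of_int (k - l)" "2 * pi * of_int (k - l) < 6"
    by (simp_all only: of_int_diff right_diff_distrib)
  have "0 < real_of_int (k - l)"
    using *(1) pi_gt_zero by (simp only: zero_less_mult_iff) simp
  then have "k - l \<ge> 1" by linarith
  then have "2 * pi * 1 \<le> 2 * pi * of_int (k - l)"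
    by (intro mult_left_mono) auto
  from le_less_trans[OF this *(2)] have "2 * pi * 1 < 6" .
  with pi_gt3 show False by simp
qed

lemma spectral_unitary_unit_vec:
  "spectral_unitary N (unit_vec N) \<theta> = diag N (\<lambda>a. exp (\<i> * complex_of_real (\<theta> a)))"
proof (rule eq_matI)
  fix a b assume "a < dim_row (diag N (\<lambda>a. exp (\<i> * complex_of_real (\<theta> a))))"
    "b < dim_col (diag N (\<lambda>a. exp (\<i> * complex_of_real (\<theta> a))))"
  then have ab: "a < N" "b < N" by (auto simp: diag_def)
  have "(\<Sum>j<N. exp (\<i> * complex_of_real (\<theta> j)) * (unit_vec N j $ a * cnj (unit_vec N j $ b))) =
    (\<Sum>j<N. if j = a then (if a = b then exp (\<i> * complex_of_real (\<theta> a)) else 0) else 0)"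
    using ab by (intro sum.cong) (auto simp: unit_vec_def)
  then show "spectral_unitary N (unit_vec N) \<theta> $$ (a, b) =
      diag N (\<lambda>a. exp (\<i> * complex_of_real (\<theta> a))) $$ (a, b)"
    using ab by (simp add: spectral_unitary_def diag_def)
qed (auto simp: spectral_unitary_def diag_def)

lemma orthonormal_basis_unit_vec: "orthonormal_basis N (unit_vec N)"
  unfolding orthonormal_basis_def
  by (auto simp: unit_vec_cscalar)

section \<open>Spans and orthogonal projections\<close>

lemma lin_span_carrier:
  assumes "X \<subseteq> carrier_vec N" "s \<in> lin_span N X"
  shows "s \<in> carrier_vec N"
proof -
  interpret vec_space "TYPE(complex)" N .
  show ?thesis
    using span_closed[of X s] assms unfolding lin_span_def by (simp only: module_vec_simps(3))
qed

text \<open>\<open>orth_proj\<close> is a definite description, so uniqueness is needed: the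
  difference of two candidates lies in the span and equals the difference of two residuals
  orthogonal to the span, hence is orthogonal to itself.\<close>

lemma orth_proj_eqI:
  assumes X: "X \<subseteq> carrier_vec N" and v: "v \<in> carrier_vec N" and p: "p \<in> lin_span N X"
    and orth: "\<And>s. s \<in> lin_span N X \<Longrightarrow> (v - p) \<bullet>c s = 0"
  shows "orth_proj N (lin_span N X) v = p"
proof -
  interpret vec_space "TYPE(complex)" N .
  have span: "lin_span N X = span X" by (simp add: lin_span_def)
  have carrier: "s \<in> carrier_vec N" if "s \<in> lin_span N X" for s
    using lin_span_carrier[OF X that] .
  have unique: "p' = p" if p': "p' \<in> lin_span N X" "\<forall>s\<in>lin_span N X. (v - p') \<bullet>c s = 0" for p'
  proof -
    define s where "s = p + (-1) \<cdot>\<^sub>v p'"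
    have "s \<in> lin_span N X"
      using p p' X span_add1[OF X, of p "(-1) \<cdot>\<^sub>v p'"] smult_in_span[OF X, of p' "-1"]
      unfolding s_def span by simp
    then have z: "(v - p) \<bullet>c s = 0" "(v - p') \<bullet>c s = 0" and sc: "s \<in> carrier_vec N"
      using orth p' carrier by auto
    note c = carrier[OF p] carrier[OF p'(1)]
    have "s = (v - p') - (v - p)"
      using c v by (intro eq_vecI) (auto simp: s_def)
    then have "s \<bullet>c s = (v - p') \<bullet>c s - (v - p) \<bullet>c s"
      using c v sc by (simp add: minus_scalar_prod_distrib[of _ N])
    then have "s = 0\<^sub>v N"
      using z conjugate_square_eq_0_vec[OF sc] by simp
    show "p' = p"
    proof (rule eq_vecI)
      fix i assume i: "i < dim_vec p"
      have "s $ i = 0" using \<open>s = 0\<^sub>v N\<close> i c by simp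
      then show "p' $ i = p $ i" using i c by (auto simp: s_def)
    qed (use c in auto)
  qed
  show ?thesis
    unfolding orth_proj_def
  proof (rule the_equality)
    show "p \<in> carrier_vec N \<and> p \<in> lin_span N X \<and> (\<forall>s\<in>lin_span N X. (v - p) \<bullet>c s = 0)"
      using carrier[OF p] p orth by blast
  qed (use unique in blast)
qed

text \<open>Used for \<open>x = unit_vec N j\<close>: vectors of a one-dimensional top eigenspace
  vanish off coordinate \<open>j\<close>.\<close>

lemma lin_span_singleton_index:
  assumes "s \<in> lin_span N {x}" "x \<in> carrier_vec N" "i < N" "x $ i = 0"
  shows "s $ i = 0"
proof -
  interpret vec_space "TYPE(complex)" N .
  obtain a A where a: "s = lincomb a A" "finite A" "A \<subseteq> {x}"
    using in_spanE assms(1) unfolding lin_span_def by metis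
  have "s $ i = (\<Sum>y\<in>A. a y * y $ i)"
    unfolding a(1) by (rule lincomb_index) (use a assms in auto)
  also have "\<dots> = 0"
    by (rule sum.neutral) (use a assms in auto)
  finally show ?thesis .
qed

lemma in_lin_span: "X \<subseteq> carrier_vec N \<Longrightarrow> x \<in> X \<Longrightarrow> x \<in> lin_span N X"
proof -
  interpret vec_space "TYPE(complex)" N .
  show "X \<subseteq> carrier_vec N \<Longrightarrow> x \<in> X \<Longrightarrow> x \<in> lin_span N X"
    using in_own_span unfolding lin_span_def by auto
qed

lemma smult_in_lin_span: "X \<subseteq> carrier_vec N \<Longrightarrow> x \<in> X \<Longrightarrow> c \<cdot>\<^sub>v x \<in> lin_span N X"
proof -
  interpret vec_space "TYPE(complex)" N .
  show "X \<subseteq> carrier_vec N \<Longrightarrow> x \<in> X \<Longrightarrow> c \<cdot>\<^sub>v x \<in> lin_span N X"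
    using in_own_span smult_in_span unfolding lin_span_def by auto
qed

section \<open>The instances and their advice\<close>

lemma theta_max_zero: "N > 0 \<Longrightarrow> theta_max N (\<lambda>_. 0) = 0"
  unfolding theta_max_def by (intro Max_eqI) auto

lemma theta_max_single: "j < N \<Longrightarrow> 0 \<le> x \<Longrightarrow> theta_max N (\<lambda>i. if i = j then x else 0) = x"
  unfolding theta_max_def by (intro Max_eqI) auto

text \<open>For the identity the top eigenspace is the whole space, so e_0 is its own
  projection.\<close>

lemma valid_advice_zero:
  assumes "N > 0" "0 \<le> \<gamma>" "\<gamma> \<le> 1"
  shows "valid_advice N \<gamma> (unit_vec N) (\<lambda>_. 0) (unit_vec N 0)"
proof -
  have "{unit_vec N j |j. j < N \<and> (0::real) = 0} \<subseteq> carrier_vec N" by auto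
  then have "orth_proj N (max_eigenspace N (unit_vec N) (\<lambda>_. 0)) (unit_vec N 0) = unit_vec N 0"
    unfolding max_eigenspace_def theta_max_zero[OF assms(1)]
  proof (rule orth_proj_eqI)
    fix s assume s: "s \<in> lin_span N {unit_vec N j |j. j < N \<and> (0::real) = 0}"
    have "s \<in> carrier_vec N"
      by (rule lin_span_carrier[OF _ s]) auto
    then show "(unit_vec N 0 - unit_vec N 0) \<bullet>c s = 0"
      by (simp add: scalar_prod_def)
  qed (use assms in \<open>auto intro!: in_lin_span\<close>)
  then show ?thesis
    using assms by (simp add: valid_advice_def norm_sq_def unit_vec_cscalar power_le_one)
qed

text \<open>The overlap with the marked e_j is exactly \<gamma>, the least allowed; all remaining
  weight lies on e_0, the advice of the identity instance.\<close>

definition advice :: "nat \<Rightarrow> real \<Rightarrow> nat \<Rightarrow> complex vec" where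
  "advice N \<gamma> j = vec N (\<lambda>i. if i = j then of_real \<gamma> else if i = 0 then of_real (sqrt (1 - \<gamma>\<^sup>2)) else 0)"

lemma advice_cscalar:
  assumes "0 < j" "j < N"
  shows "advice N \<gamma> j \<bullet>c unit_vec N 0 = of_real (sqrt (1 - \<gamma>\<^sup>2))"
  using assms by (subst cscalar_unit_vec) (auto simp: advice_def)

lemma advice_norm:
  assumes "0 < j" "j < N" "0 \<le> \<gamma>" "\<gamma> \<le> 1"
  shows "norm_sq (advice N \<gamma> j) = 1"
proof -
  have "norm_sq (advice N \<gamma> j) = (\<Sum>i<N. (if i = j then \<gamma>\<^sup>2 else 0) + (if i = 0 then 1 - \<gamma>\<^sup>2 else 0))"
    unfolding norm_sq_sum
    by (rule sum.cong) (use assms power_le_one[of \<gamma> 2] in \<open>auto simp: advice_def\<close>)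
  then show ?thesis using assms by (simp add: sum.distrib)
qed

lemma valid_advice_single:
  assumes j: "0 < j" "j < N" and \<gamma>: "0 \<le> \<gamma>" "\<gamma> \<le> 1" and x: "0 < x"
  shows "valid_advice N \<gamma> (unit_vec N) (\<lambda>i. if i = j then x else 0) (advice N \<gamma> j)"
proof -
  let ?p = "of_real \<gamma> \<cdot>\<^sub>v unit_vec N j :: complex vec"
  have *: "{unit_vec N i |i. i < N \<and> (if i = j then x else 0) = x} = {unit_vec N j}"
    using j x by auto
  have S: "max_eigenspace N (unit_vec N) (\<lambda>i. if i = j then x else 0) = lin_span N {unit_vec N j}"
    unfolding max_eigenspace_def theta_max_single[OF j(2) less_imp_le[OF x]] * ..
  have "orth_proj N (lin_span N {unit_vec N j}) (advice N \<gamma> j) = ?p"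
  proof (rule orth_proj_eqI)
    fix s :: "complex vec" assume s: "s \<in> lin_span N {unit_vec N j}"
    have sc: "s \<in> carrier_vec N"
      by (rule lin_span_carrier[OF _ s]) auto
    \<comment> \<open>In each coordinate one factor of the inner product vanishes: \<open>s\<close>
      off \<open>j\<close>, and the residual at \<open>j\<close>.\<close>
    have "s $ i = 0 \<or> i = j" if "i < N" for i
      using lin_span_singleton_index[OF s _ that] that by (cases "i = j") (simp_all add: unit_vec_def)
    then have "(advice N \<gamma> j - ?p) $ i * cnj (s $ i) = 0" if "i < N" for i
      using that j by (cases "i = j") (auto simp: advice_def)
    with sc show "(advice N \<gamma> j - ?p) \<bullet>c s = 0"
      unfolding scalar_prod_def by (intro sum.neutral) (simp del: mult_eq_0_iff)
  qed (auto simp: advice_def intro!: smult_in_lin_span)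
  moreover have "norm_sq ?p = \<gamma>\<^sup>2"
    using j unit_vec_cscalar[OF j(2,2)] by (simp add: norm_sq_def power2_eq_square)
  ultimately show ?thesis
    using advice_norm[OF j \<gamma>] S by (simp add: valid_advice_def) (simp add: advice_def)
qed

text \<open>A chord of the unit circle is no longer than its arc; the chord is
  \<open>2 * \<bar>sin (x / 2)\<bar>\<close>.\<close>

lemma cmod_exp_minus_one_le: "cmod (exp (\<i> * complex_of_real x) - 1) \<le> \<bar>x\<bar>"
  using abs_sin_x_le_abs_x[of "x / 2"] by (simp add: dist_exp_i_1)

section \<open>The lower bound\<close>

lemma initial_state_norm_sq:
  assumes "\<alpha> \<in> carrier_vec N" "norm_sq \<alpha> = 1" "N > 0" "anc_dim A > 0"
  shows "norm_sq (initial_state N t A \<alpha>) = 1"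
proof -
  have "\<alpha> \<bullet>c \<alpha> = of_real (norm_sq \<alpha>)"
    using conjugate_square_ge_0_vec[of \<alpha>] by (simp add: norm_sq_def complex_eq_iff less_eq_complex_def)
  then show ?thesis
    using initial_state_cscalar[OF assms(1,1,3,4), of t] assms(2) by (simp add: norm_sq_def)
qed

text \<open>For unit vectors the squared distance is 2 minus twice the real part of the inner
  product, here the \<open>t\<close>-th power of \<open>sqrt (1 - \<gamma>\<^sup>2)\<close>.\<close>

lemma initial_state_dist:
  assumes j: "0 < j" "j < N" and \<gamma>: "0 \<le> \<gamma>" "\<gamma> \<le> 1" and A: "anc_dim A > 0"
  shows "norm_sq (initial_state N t A (advice N \<gamma> j) - initial_state N t A (unit_vec N 0)) \<le> 2 * (real t * \<gamma>\<^sup>2)"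
proof -
  have N: "N > 0" using j by simp
  have c: "advice N \<gamma> j \<in> carrier_vec N" "unit_vec N 0 \<in> carrier_vec N"
    by (auto simp: advice_def)
  have g: "\<gamma>\<^sup>2 \<le> 1" using \<gamma> by (simp add: power_le_one)
  \<comment> \<open>Bernoulli is applied to \<open>1 - \<gamma>\<^sup>2\<close> itself; as this lies
    in [0, 1], its square root is at least as large.\<close>
  have "1 + real t * (- \<gamma>\<^sup>2) \<le> (1 + (- \<gamma>\<^sup>2)) ^ t"
    using g by (intro Bernoulli_inequality) auto
  also have "\<dots> \<le> sqrt (1 - \<gamma>\<^sup>2) ^ t"
  proof (rule power_mono)
    have "(1 - \<gamma>\<^sup>2)\<^sup>2 \<le> 1 - \<gamma>\<^sup>2"
      using g by (simp add: power2_eq_square mult_left_le)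
    then show "1 + - \<gamma>\<^sup>2 \<le> sqrt (1 - \<gamma>\<^sup>2)"
      by (simp add: real_le_rsqrt)
  qed (use g in simp)
  finally have "1 - real t * \<gamma>\<^sup>2 \<le> sqrt (1 - \<gamma>\<^sup>2) ^ t" by simp
  moreover have "initial_state N t A (advice N \<gamma> j) \<bullet>c initial_state N t A (unit_vec N 0) = of_real (sqrt (1 - \<gamma>\<^sup>2) ^ t)"
    by (simp only: initial_state_cscalar[OF c N A] advice_cscalar[OF j] of_real_power)
  moreover note norm_sq_unit_vec[OF N]
  ultimately show ?thesis
    using norm_sq_minus[OF initial_state_carrier[OF c(1), of t A] initial_state_carrier[OF c(2), of t A]]
      initial_state_norm_sq[OF c(1) advice_norm[OF j \<gamma>] N A, of t] initial_state_norm_sq[OF c(2) _ N A, of t]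
    by simp
qed

lemma final_state_run:
  "final_state N t A U \<alpha> = run N (work_dim N t A) U (gates A) (initial_state N t A \<alpha>)"
  by (simp add: final_state_def run_def)

text \<open>One algorithm must answer near 3 \<delta> on the first instance and near 0 on the
  second. The eigenphase 3 \<delta> exceeds 2 \<delta>, so the answer windows are disjoint and the
  measurement distinguishes the final states.\<close>

lemma final_states_far:
  assumes A: "solves_maxqpe_known N \<delta> \<gamma> t A" and j: "0 < j" "j < N"
    and \<gamma>: "0 \<le> \<gamma>" "\<gamma> \<le> 1" and \<delta>: "0 < \<delta>" "\<delta> < 1"
  shows "norm_sq (final_state N t A (diag N (\<lambda>i. if i = j then exp (\<i> * complex_of_real (3 * \<delta>)) else 1)) (advice N \<gamma> j)
    - final_state N t A (diag N (\<lambda>_. 1)) (unit_vec N 0)) \<ge> 1 / 18"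
proof -
  let ?\<theta> = "\<lambda>i. if i = j then 3 * \<delta> else 0"
  let ?d = "\<lambda>i. if i = j then exp (\<i> * complex_of_real (3 * \<delta>)) else 1"
  let ?w = "work_dim N t A"
  have N: "N > 0" and ok: "algorithm_ok N t A" and corr: "correct_on N \<delta> \<gamma> t A (unit_vec N)"
    using j A by (auto simp: solves_maxqpe_known_def)
  have "spectral_unitary N (unit_vec N) ?\<theta> = diag N ?d"
    unfolding spectral_unitary_unit_vec by (rule diag_cong) auto
  \<comment> \<open>The promise asks for 3 \<delta> < 2 pi - 2 \<delta>, which holds because 5
    \<delta> < 5 < 2 pi.\<close>
  moreover have "maxqpe_promise N \<delta> (unit_vec N) ?\<theta>"
    using theta_max_single[OF j(2), of "3 * \<delta>"] \<delta> pi_gt3 orthonormal_basis_unit_vec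
    by (auto simp: maxqpe_promise_def)
  moreover have "valid_advice N \<gamma> (unit_vec N) ?\<theta> (advice N \<gamma> j)"
    using j \<gamma> \<delta> by (intro valid_advice_single) auto
  ultimately have p1: "output_prob N t A (diag N ?d) (advice N \<gamma> j) (good_outputs \<delta> (3 * \<delta>)) \<ge> 2 / 3"
    using corr theta_max_single[OF j(2), of "3 * \<delta>"] \<delta> unfolding correct_on_def by fastforce
  have "spectral_unitary N (unit_vec N) (\<lambda>_. 0) = diag N (\<lambda>_. 1)"
    unfolding spectral_unitary_unit_vec by (rule diag_cong) auto
  moreover have "maxqpe_promise N \<delta> (unit_vec N) (\<lambda>_. 0)"
    using theta_max_zero[OF N] \<delta> pi_gt3 orthonormal_basis_unit_vec by (auto simp: maxqpe_promise_def)
  ultimately have p2: "output_prob N t A (diag N (\<lambda>_. 1)) (unit_vec N 0) (good_outputs \<delta> 0) \<ge> 2 / 3"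
    using corr valid_advice_zero[OF N \<gamma>] theta_max_zero[OF N] unfolding correct_on_def by fastforce
  have gates: "\<forall>g\<in>set (gates A). gate_ok N ?w g" and E: "is_povm (N * ?w) (measurement A)"
    and anc: "anc_dim A > 0"
    using ok by (auto simp: algorithm_ok_def)
  have i1: "initial_state N t A (advice N \<gamma> j) \<in> carrier_vec (N * ?w)"
    by (rule initial_state_carrier) (simp add: advice_def)
  have i0: "initial_state N t A (unit_vec N 0) \<in> carrier_vec (N * ?w)"
    by (rule initial_state_carrier) simp
  have "norm_sq (final_state N t A (diag N (\<lambda>_. 1)) (unit_vec N 0)) = 1"
    unfolding final_state_run vnorm_power2[symmetric]
    by (subst run_vnorm[OF gates i0])
      (simp_all add: vnorm_power2 initial_state_norm_sq N anc norm_sq_unit_vec)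
  then show ?thesis
    using povm_distinguish[OF E good_outputs_borel good_outputs_borel good_outputs_disjoint[OF \<delta>]
        run_carrier[OF gates i1] run_carrier[OF gates i0]] p1 p2
    by (simp add: output_prob_def Let_def quad_form_def final_state_run)
qed

text \<open>Each of the \<open>N - 1\<close> marked instances must grow in distance from at most
  1/10 to at least 1/5. With \<open>M = sqrt (N - 1)\<close> the hybrid bound gives
  \<open>M\<^sup>2 / 10 \<le> 3 * \<delta> * M * cost A\<close>, and dividing by \<open>M\<close>
  leaves a bound linear in \<open>M\<close>.\<close>

lemma maxqpe_query_lower_bound:
  assumes A: "solves_maxqpe_known N \<delta> \<gamma> t A" and N: "N \<ge> 2"
    and \<gamma>: "0 \<le> \<gamma>" "\<gamma> \<le> 1" and \<delta>: "0 < \<delta>" "\<delta> < 1" and t: "real t * \<gamma>\<^sup>2 \<le> 1 / 200"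
  shows "real (cost A) \<ge> 1 / 60 * sqrt (real N) / \<delta>"
proof -
  \<comment> \<open>Index 0 is left out: e_0 is the reference advice and carries the rest of each
    marked advice state.\<close>
  let ?w = "work_dim N t A" and ?J = "{1..<N}"
  define d where "d j i = (if i = j then exp (\<i> * complex_of_real (3 * \<delta>)) else 1)" for i j :: nat
  let ?v = "initial_state N t A (unit_vec N 0)" and ?v' = "\<lambda>j. initial_state N t A (advice N \<gamma> j)"
  let ?D = "\<lambda>j. vnorm (run N ?w (diag N (d j)) (gates A) (?v' j) - run N ?w (diag N (\<lambda>_. 1)) (gates A) ?v)"
  have gates: "\<forall>g\<in>set (gates A). gate_ok N ?w g" and anc: "anc_dim A > 0"
    using A by (auto simp: algorithm_ok_def solves_maxqpe_known_def)
  have far: "1 / 5 \<le> ?D j" if "j \<in> ?J" for j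
  proof -
    have "(1 / 5)\<^sup>2 \<le> (1 / 18 :: real)" by (simp add: power2_eq_square)
    also have "\<dots> \<le> (?D j)\<^sup>2"
      using final_states_far[OF A _ _ \<gamma> \<delta>, of j] that
      by (simp add: vnorm_power2 final_state_run d_def[abs_def])
    finally show ?thesis by (rule power2_le_imp_le) (rule vnorm_nonneg)
  qed
  have near: "vnorm (?v' j - ?v) \<le> 1 / 10" if "j \<in> ?J" for j
  proof -
    \<comment> \<open>The threshold 1/200 on \<open>t * \<gamma>\<^sup>2\<close> makes the squared
      initial distance at most 1/100.\<close>
    have "(vnorm (?v' j - ?v))\<^sup>2 \<le> (1 / 10)\<^sup>2"
      using initial_state_dist[of j N \<gamma> A t] that \<gamma> anc t unfolding vnorm_power2 by (simp add: power_divide)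
    then show ?thesis by (rule power2_le_imp_le) simp
  qed
  have v1: "vnorm ?v = 1"
    using N anc by (simp add: vnorm_sqrt initial_state_norm_sq norm_sq_unit_vec)
  define M where "M = sqrt (real (card ?J))"
  have M: "M > 0" "M\<^sup>2 = real (card ?J)" using N by (auto simp: M_def)
  have "M\<^sup>2 * (1 / 5) = (\<Sum>j\<in>?J. 1 / 5)" using M by simp
  also have "\<dots> \<le> (\<Sum>j\<in>?J. ?D j)" by (rule sum_mono) (rule far)
  also have "\<dots> \<le> (\<Sum>j\<in>?J. vnorm (?v' j - ?v)) + 3 * \<delta> * M * real (cost A) * vnorm ?v"
    unfolding M_def cost_def
  proof (rule hybrid_bound[OF _ gates])
    show "cmod (d j j - 1) \<le> 3 * \<delta>" for j
      using cmod_exp_minus_one_le[of "3 * \<delta>"] \<delta> by (simp add: d_def)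
  qed (auto simp: d_def advice_def intro!: initial_state_carrier)
  also have "\<dots> \<le> (\<Sum>j\<in>?J. 1 / 10) + 3 * \<delta> * M * real (cost A)"
    using near by (intro add_mono sum_mono) (auto simp: v1)
  also have "(\<Sum>j\<in>?J. 1 / 10) = M\<^sup>2 * (1 / 10 :: real)" using M by simp
  finally have "M * M \<le> M * (30 * \<delta> * real (cost A))"
    by (simp add: power2_eq_square algebra_simps)
  then have "M \<le> 30 * \<delta> * real (cost A)"
    using M(1) by (simp only: mult_le_cancel_left_pos)
  \<comment> \<open>For \<open>N \<ge> 2\<close> one has \<open>N \<le> 4 * (N - 1)\<close>; the
    factor 2 turns 1/30 into the constant 1/60.\<close>
  moreover have "sqrt (real N) \<le> 2 * M"
    using N by (intro real_le_lsqrt) (use M in \<open>auto simp: power_mult_distrib less_imp_le\<close>)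
  ultimately show ?thesis
    using \<delta> by (simp add: field_simps)
qed

theorem lemma3p3:
  fixes N t :: "nat \<Rightarrow> nat" and \<gamma> \<delta> :: "nat \<Rightarrow> real"
  assumes "\<And>n. n \<ge> 1 \<Longrightarrow> N n \<ge> 2"
    and "\<And>n. n \<ge> 1 \<Longrightarrow> 1 / sqrt (real (N n)) \<le> \<gamma> n \<and> \<gamma> n \<le> 1"
    and "\<And>n. n \<ge> 1 \<Longrightarrow> 0 < \<delta> n \<and> \<delta> n < 1"
    and "(\<lambda>n. real (t n) * (\<gamma> n)\<^sup>2) \<longlonglongrightarrow> 0"
  shows "\<exists>c>0. \<exists>n\<^sub>0\<ge>1. \<forall>n\<ge>n\<^sub>0. \<forall>A :: algorithm.
     (solves_maxqpe_known (N n) (\<delta> n) (\<gamma> n) (t n) A \<longrightarrow>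
        real (cost A) \<ge> c * sqrt (real (N n)) / \<delta> n) \<and>
     (solves_maxqpe_unknown (N n) (\<delta> n) (\<gamma> n) (t n) A \<longrightarrow>
        real (cost A) \<ge> c * sqrt (real (N n)) / \<delta> n)"
proof -
  \<comment> \<open>The limit only determines from which index on the threshold 1/200 holds; the
    constant 1/60 is the same for all sequences.\<close>
  have "eventually (\<lambda>n. real (t n) * (\<gamma> n)\<^sup>2 < 1 / 200) sequentially"
    by (rule order_tendstoD(2)[OF assms(4)]) simp
  then obtain n\<^sub>1 where n\<^sub>1: "\<And>n. n \<ge> n\<^sub>1 \<Longrightarrow> real (t n) * (\<gamma> n)\<^sup>2 < 1 / 200"
    by (auto simp: eventually_sequentially)
  have known: "real (cost A) \<ge> 1 / 60 * sqrt (real (N n)) / \<delta> n"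
    if n: "n \<ge> max 1 n\<^sub>1" and A: "solves_maxqpe_known (N n) (\<delta> n) (\<gamma> n) (t n) A" for n A
  proof (rule maxqpe_query_lower_bound[OF A])
    have "0 \<le> 1 / sqrt (real (N n))" by simp
    then show "0 \<le> \<gamma> n" using assms(2)[of n] n by linarith
  qed (use assms(1-3)[of n] n n\<^sub>1[of n] in auto)
  \<comment> \<open>Correctness for every eigenbasis is specialised to the computational
    one.\<close>
  have "solves_maxqpe_known (N n) (\<delta> n) (\<gamma> n) (t n) A"
    if "solves_maxqpe_unknown (N n) (\<delta> n) (\<gamma> n) (t n) A" for n A
    using that by (simp add: solves_maxqpe_known_def solves_maxqpe_unknown_def)
  with known show ?thesis
    by (intro exI[of _ "1 / 60"] conjI exI[of _ "max 1 n\<^sub>1"]) auto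
qed

end
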